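(* Let $a<b$, $\alpha>0$ and $f\in C[a,b]$. Moreover, assume that $g$ is Lebesgue integrable on $[a,b]$ and that $g$ does not change its sign in this interval. Then, for almost every $x\in(a,b]$ there exists some $\xi\in(a,x)\subset(a,b)$ such that $$J_a^\alpha(fg)(x)=f(\xi)\,J_a^\alpha g(x).$$ If additionally $\alpha\ge 1$ or $g\in C[a,b]$, then this result holds for every $x\in(a,b]$.
   Context: All functions are real-valued. For $\alpha>0$ and $a\in\mathbb{R}$, the Riemann-Liouville integral operator of order $\alpha$ with starting point $a$ is $$J_a^\alpha h(x):=\frac{1}{\Gamma(\alpha)}\int_a^x (x-t)^{\alpha-1}h(t)\,\mathrm{d}t,\qquad x\ge a,$$ with the integral understood in the Lebesgue sense. The function $g$ does not change its sign in $[a,b]$ if either $g\ge 0$ on $[a,b]$ or $g\le 0$ on $[a,b]$. *)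

theory Defs
  imports "HOL-Analysis.Analysis"
begin

text \<open>
  The Bochner integral is total and returns 0 for a non-integrable function, so the existence of
  the Riemann-Liouville integral at a point is a separate predicate.
  In Isabelle, \<open>0 powr 0 = 0\<close>; for \<open>\<alpha> = 1\<close> the kernel therefore differs from
  the constant 1 at the single point \<open>t = x\<close>, which does not affect the integral.
\<close>

definition RL_kernel :: "real \<Rightarrow> real \<Rightarrow> real \<Rightarrow> real" where
  "RL_kernel \<alpha> x t = (x - t) powr (\<alpha> - 1)"

definition RL_exists :: "real \<Rightarrow> real \<Rightarrow> (real \<Rightarrow> real) \<Rightarrow> real \<Rightarrow> bool" where
  "RL_exists \<alpha> a h x \<longleftrightarrow> set_integrable lebesgue {a..x} (\<lambda>t. RL_kernel \<alpha> x t * h t)"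

definition RL_integral :: "real \<Rightarrow> real \<Rightarrow> (real \<Rightarrow> real) \<Rightarrow> real \<Rightarrow> real" where
  "RL_integral \<alpha> a h x =
     1 / Gamma \<alpha> * (LINT t:{a..x}|lebesgue. RL_kernel \<alpha> x t * h t)"

definition no_sign_change_on :: "real set \<Rightarrow> (real \<Rightarrow> real) \<Rightarrow> bool" where
  "no_sign_change_on S g \<longleftrightarrow> (\<forall>x\<in>S. g x \<ge> 0) \<or> (\<forall>x\<in>S. g x \<le> 0)"

end

theory Submission
  imports Defs
begin

text \<open>
  For fixed \<open>x\<close> the claim is the mean value theorem for integrals on \<open>[a, x]\<close>, with the weight
  \<open>w t = (x - t) powr (\<alpha> - 1) * g t\<close>. The kernel is nonnegative, so \<open>w\<close> inherits the constant sign
  of \<open>g\<close>, and the factor \<open>1 / Gamma \<alpha>\<close> stands on both sides. Wherever \<open>w\<close> is integrable, a point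
  \<open>\<xi>\<close> therefore exists (\<open>weighted_mean_value_interior\<close>). It can be taken in the open interval:
  if \<open>f\<close> missed its weighted mean \<open>\<mu>\<close> throughout \<open>(a, x)\<close>, then \<open>f - \<mu>\<close> would keep a strict sign
  there, and \<open>(f - \<mu>) w\<close>, a function of one sign with integral zero, would vanish almost everywhere,
  which forces \<open>w\<close> to vanish almost everywhere; but for such \<open>w\<close> both integrals are zero and any
  point serves.

  What remains is the integrability of \<open>w\<close>, that is, the existence of the Riemann-Liouville integral
  of \<open>g\<close> at \<open>x\<close>. For \<open>\<alpha> < 1\<close> the kernel is unbounded near \<open>t = x\<close>, but it is a translate and
  reflection of an integrable power. The integral of \<open>w\<close> is then a convolution of two integrable
  functions, so by Fubini it exists for almost every \<open>x\<close> (\<open>AE_RL_exists\<close>). It exists at every \<open>x\<close>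
  as soon as one of the two factors is bounded: the kernel if \<open>\<alpha> \<ge> 1\<close>
  (\<open>RL_exists_of_order_ge_1\<close>), or \<open>g\<close> if it is continuous (\<open>RL_exists_of_continuous\<close>).
\<close>

section \<open>Convolution of integrable functions\<close>

text \<open>
  A Lebesgue integrable \<open>g\<close> need not be Borel measurable. With \<open>\<sigma>\<close>-finiteness of the completed
  measure, Fubini applies to \<open>g\<close> itself, without passing to a Borel representative.
\<close>

lemma sigma_finite_measure_completion:
  assumes "sigma_finite_measure M"
  shows "sigma_finite_measure (completion M)"
proof -
  obtain A where "countable A" "A \<subseteq> sets M" "\<Union>A = space M" "\<forall>a\<in>A. emeasure M a \<noteq> \<infinity>"
    using sigma_finite_measure.sigma_finite_countable[OF assms] by blast
  then show ?thesis
    by (intro sigma_finite_measure.intro exI[of _ A]) (auto simp: subset_iff)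
qed

text \<open>
  By translation invariance, integrating \<open>\<bar>k (x - t) * h t\<bar>\<close> over \<open>x\<close> first gives the constant
  \<open>\<integral>\<bar>k\<bar>\<close> times \<open>\<bar>h t\<bar>\<close>, which is integrable in \<open>t\<close>. So \<open>k (x - t) * h t\<close> is integrable over the
  plane, and almost all of its slices are integrable. The function \<open>k\<close> is taken Borel measurable so
  that its composition with the subtraction is measurable for the product measure.
\<close>

lemma AE_integrable_convolution:
  fixes k h :: "real \<Rightarrow> real"
  assumes k: "integrable lborel k" and h: "integrable lebesgue h"
  shows "AE x in lborel. integrable lebesgue (\<lambda>t. k (x - t) * h t)"
proof -
  interpret lebesgue: sigma_finite_measure "lebesgue :: real measure"
    by (rule sigma_finite_measure_completion) (rule lborel.sigma_finite_measure_axioms)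
  interpret pair_sigma_finite "lebesgue :: real measure" "lborel :: real measure" ..
  interpret swap: pair_sigma_finite "lborel :: real measure" "lebesgue :: real measure" ..
  have [measurable]: "k \<in> borel_measurable borel" "h \<in> borel_measurable lebesgue"
    using k h by (auto dest: borel_measurable_integrable)
  have [measurable]: "(\<lambda>t. t) \<in> lebesgue \<rightarrow>\<^sub>M (borel :: real measure)"
    by (simp add: measurable_completion)
  have [measurable]: "fst \<in> lebesgue \<Otimes>\<^sub>M lborel \<rightarrow>\<^sub>M (borel :: real measure)"
    by (rule measurable_compose[OF measurable_fst]) measurable
  have shift: "integrable lborel (\<lambda>x. k (x - t))" for t
    using lborel_integrable_real_affine[OF k, of 1 "- t"] by (simp add: add.commute)
  have "(\<integral>x. \<bar>k (x - t)\<bar> \<partial>lborel) = (\<integral>x. \<bar>k x\<bar> \<partial>lborel)" for t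
    using lborel_integral_real_affine[of 1 "\<lambda>x. \<bar>k x\<bar>" "- t"] by (simp add: add.commute)
  then have norm_slice:
    "(\<integral>x. norm (k (x - t) * h t) \<partial>lborel) = (\<integral>x. \<bar>k x\<bar> \<partial>lborel) * \<bar>h t\<bar>" for t
    by (simp add: abs_mult)
  have "integrable (lebesgue \<Otimes>\<^sub>M lborel) (\<lambda>(t, x). k (x - t) * h t)"
  proof (rule Fubini_integrable)
    show "(\<lambda>(t, x). k (x - t) * h t) \<in> borel_measurable (lebesgue \<Otimes>\<^sub>M lborel)"
      unfolding case_prod_beta by measurable
    show "integrable lebesgue (\<lambda>t. \<integral>x. norm (case (t, x) of (t, x) \<Rightarrow> k (x - t) * h t) \<partial>lborel)"
      using h by (simp only: norm_slice prod.case) (intro integrable_mult_right integrable_abs)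
    show "AE t in lebesgue. integrable lborel (\<lambda>x. case (t, x) of (t, x) \<Rightarrow> k (x - t) * h t)"
      using shift by simp
  qed
  from AE_integrable_snd[OF this] show ?thesis .
qed

section \<open>The mean value theorem with an integrable weight\<close>

text \<open>
  A nonzero factor makes the function nonnegative without changing its zeros, so the two signs
  need no separate treatment.
\<close>

lemma no_sign_change_on_normalize:
  assumes "no_sign_change_on S w"
  obtains \<sigma> :: real where "\<sigma> \<noteq> 0" "\<And>t. t \<in> S \<Longrightarrow> 0 \<le> \<sigma> * w t"
proof -
  consider "\<forall>t\<in>S. 0 \<le> w t" | "\<forall>t\<in>S. w t \<le> 0"
    using assms by (auto simp: no_sign_change_on_def)
  then show ?thesis
  proof cases
    case 1
    then show ?thesis by (intro that[of 1]) auto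
  next
    case 2
    then show ?thesis by (intro that[of "-1"]) auto
  qed
qed

lemma no_sign_change_on_nonzero:
  fixes h :: "real \<Rightarrow> real"
  assumes "continuous_on S h" "connected S" and nonzero: "\<And>t. t \<in> S \<Longrightarrow> h t \<noteq> 0"
  shows "no_sign_change_on S h"
proof (rule ccontr)
  assume "\<not> no_sign_change_on S h"
  then obtain s t where "s \<in> S" "h s \<le> 0" "t \<in> S" "0 \<le> h t"
    unfolding no_sign_change_on_def by (meson linear)
  moreover have "connected (h ` S)"
    using assms by (intro connected_continuous_image)
  ultimately have "0 \<in> h ` S"
    by (meson connectedD_interval imageI)
  with nonzero show False
    by auto
qed

lemma set_integrable_continuous_mult:
  fixes f w :: "real \<Rightarrow> real"
  assumes f: "continuous_on {a..x} f" and w: "set_integrable lebesgue {a..x} w"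
  shows "set_integrable lebesgue {a..x} (\<lambda>t. f t * w t)"
proof (rule absolutely_integrable_bounded_measurable_product_real)
  show "f \<in> borel_measurable (lebesgue_on {a..x})"
    using f by (intro continuous_imp_measurable_on_sets_lebesgue) auto
  show "bounded (f ` {a..x})"
    using f by (intro compact_imp_bounded compact_continuous_image) auto
qed (use w in auto)

text \<open>
  If the weight has integral zero, it vanishes almost everywhere, both integrals are zero, and any
  interior point serves. Otherwise the weighted mean \<open>\<mu>\<close> of \<open>f\<close> is defined, and
  \<open>(f - \<mu>) w\<close> has integral zero. If \<open>\<mu>\<close> were not attained on the open interval, this product would
  have one sign up to the two endpoints and hence vanish almost everywhere. As \<open>f - \<mu>\<close> has no
  interior zero, \<open>w\<close> would then vanish almost everywhere, against its nonzero integral.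
\<close>

lemma weighted_mean_value_interior:
  fixes f w :: "real \<Rightarrow> real"
  assumes "a < x" and f: "continuous_on {a..x} f"
    and w: "set_integrable lebesgue {a..x} w" and sign: "no_sign_change_on {a..x} w"
  shows "\<exists>\<xi>\<in>{a<..<x}. (LINT t:{a..x}|lebesgue. f t * w t) = f \<xi> * (LINT t:{a..x}|lebesgue. w t)"
proof (cases "(LINT t:{a..x}|lebesgue. w t) = 0")
  case True
  obtain \<sigma> :: real where \<sigma>: "\<sigma> \<noteq> 0" "\<And>t. t \<in> {a..x} \<Longrightarrow> 0 \<le> \<sigma> * w t"
    using no_sign_change_on_normalize[OF sign] by blast
  have "integral\<^sup>L lebesgue (\<lambda>t. \<sigma> * (indicator {a..x} t * w t)) = 0"
    using True by (simp add: set_lebesgue_integral_def)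
  then have "AE t in lebesgue. \<sigma> * (indicator {a..x} t * w t) = 0"
    using w \<sigma>(2) by (subst (asm) integral_nonneg_eq_0_iff_AE)
      (auto simp: set_integrable_def indicator_def)
  then have "(LINT t:{a..x}|lebesgue. f t * w t) = 0"
    unfolding set_lebesgue_integral_def using \<sigma>(1) by (intro integral_eq_zero_AE) auto
  then show ?thesis
    using True \<open>a < x\<close> dense by fastforce
next
  case False
  define \<mu> where "\<mu> = (LINT t:{a..x}|lebesgue. f t * w t) / (LINT t:{a..x}|lebesgue. w t)"
  have "\<exists>\<xi>\<in>{a<..<x}. f \<xi> = \<mu>"
  proof (rule ccontr)
    assume no: "\<not> ?thesis"
    have dev: "set_integrable lebesgue {a..x} (\<lambda>t. (f t - \<mu>) * w t)"
      using f w by (intro set_integrable_continuous_mult continuous_intros)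
    have "(LINT t:{a..x}|lebesgue. (f t - \<mu>) * w t) =
      (LINT t:{a..x}|lebesgue. f t * w t) - \<mu> * (LINT t:{a..x}|lebesgue. w t)"
      using set_integrable_continuous_mult[OF f w] w
      by (simp add: left_diff_distrib set_integral_diff)
    then have zero: "(LINT t:{a..x}|lebesgue. (f t - \<mu>) * w t) = 0"
      using False by (simp add: \<mu>_def)
    obtain \<tau> :: real where \<tau>: "\<tau> \<noteq> 0" "\<And>t. t \<in> {a<..<x} \<Longrightarrow> 0 \<le> \<tau> * (f t - \<mu>)"
    proof (rule no_sign_change_on_normalize)
      show "no_sign_change_on {a<..<x} (\<lambda>t. f t - \<mu>)"
      proof (rule no_sign_change_on_nonzero)
        show "continuous_on {a<..<x} (\<lambda>t. f t - \<mu>)"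
          by (intro continuous_intros continuous_on_subset[OF f]) auto
      qed (use no in auto)
    qed blast
    obtain \<sigma> :: real where \<sigma>: "\<sigma> \<noteq> 0" "\<And>t. t \<in> {a..x} \<Longrightarrow> 0 \<le> \<sigma> * w t"
      using no_sign_change_on_normalize[OF sign] by blast
    (* The sign of f - \<mu> and its zeros are controlled in the interior only. *)
    have ends: "AE t in lebesgue. t \<noteq> a \<and> t \<noteq> x"
      using AE_lborel_singleton[of a] AE_lborel_singleton[of x] by (intro AE_completion) auto
    let ?v = "\<lambda>t. (\<tau> * \<sigma>) * (indicator {a..x} t * ((f t - \<mu>) * w t))"
    have nonneg: "AE t in lebesgue. 0 \<le> ?v t"
      using ends
    proof eventually_elim
      case (elim t)
      then have "0 \<le> (\<tau> * (f t - \<mu>)) * (\<sigma> * w t)" if "t \<in> {a..x}"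
        using that by (intro mult_nonneg_nonneg \<tau> \<sigma>) auto
      then show ?case
        by (auto simp: indicator_def mult_ac)
    qed
    have "integral\<^sup>L lebesgue ?v = 0"
      using zero by (simp add: set_lebesgue_integral_def)
    moreover have "integrable lebesgue ?v"
      using dev unfolding set_integrable_def by (intro integrable_mult_right) simp
    ultimately have "AE t in lebesgue. ?v t = 0"
      using nonneg by (subst (asm) integral_nonneg_eq_0_iff_AE)
    then have "AE t in lebesgue. indicator {a..x} t *\<^sub>R w t = 0"
      using ends
    proof eventually_elim
      case (elim t)
      then show ?case
        using \<tau>(1) \<sigma>(1) no by (auto simp: indicator_def split: if_splits)
    qed
    then show False
      using False unfolding set_lebesgue_integral_def by (metis integral_eq_zero_AE)
  qed
  moreover have "(LINT t:{a..x}|lebesgue. f t * w t) = \<mu> * (LINT t:{a..x}|lebesgue. w t)"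
    using False by (simp add: \<mu>_def)
  ultimately show ?thesis
    by metis
qed

section \<open>The Riemann-Liouville kernel\<close>

lemma integrable_truncated_powr:
  fixes p c :: real
  assumes "p > -1" "c \<ge> 0"
  shows "integrable lborel (\<lambda>s. indicator {0..c} s * s powr p)"
proof -
  have "(\<lambda>s. s powr p) absolutely_integrable_on {0..c}"
    using has_integral_powr_from_0[OF assms]
    by (intro nonnegative_absolutely_integrable_1) auto
  then show ?thesis
    unfolding set_integrable_def by (subst (asm) integrable_completion) auto
qed

lemma RL_kernel_nonneg: "RL_kernel \<alpha> x t \<ge> 0"
  by (simp add: RL_kernel_def)

lemma RL_kernel_measurable [measurable]: "RL_kernel \<alpha> x \<in> borel_measurable borel"
  unfolding RL_kernel_def by measurable

text \<open>
  The substitution \<open>s = x - t\<close> turns the kernel into the power \<open>s powr (\<alpha> - 1)\<close> on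
  \<open>[0, x - a]\<close>, whose exponent exceeds \<open>-1\<close> because \<open>\<alpha> > 0\<close>.
\<close>

lemma set_integrable_RL_kernel:
  assumes "\<alpha> > 0" "a \<le> x"
  shows "set_integrable lebesgue {a..x} (RL_kernel \<alpha> x)"
proof -
  have "integrable lborel (\<lambda>t. indicator {0..x - a} (x - t) * (x - t) powr (\<alpha> - 1))"
    using lborel_integrable_real_affine[OF integrable_truncated_powr[of "\<alpha> - 1" "x - a"], of "-1" x]
      assms by simp
  also have "(\<lambda>t. indicator {0..x - a} (x - t) * (x - t) powr (\<alpha> - 1)) =
      (\<lambda>t. indicator {a..x} t *\<^sub>R RL_kernel \<alpha> x t)"
    by (auto simp: RL_kernel_def indicator_def)
  finally show ?thesis
    unfolding set_integrable_def by (subst integrable_completion) auto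
qed

text \<open>
  One power function truncated to \<open>[0, b - a]\<close> serves all \<open>x\<close> in \<open>(a, b]\<close> at once: in its
  convolution with \<open>g\<close> restricted to \<open>[a, b]\<close>, the two cut-offs leave exactly the
  points \<open>t\<close> of \<open>[a, x]\<close>.
\<close>

lemma AE_RL_exists:
  assumes "\<alpha> > 0" "a < b" and g: "set_integrable lebesgue {a..b} g"
  shows "AE x\<in>{a<..b} in lebesgue. RL_exists \<alpha> a g x"
proof -
  have "AE x in lborel. integrable lebesgue (\<lambda>t.
      (indicator {0..b - a} (x - t) * (x - t) powr (\<alpha> - 1)) * (indicator {a..b} t *\<^sub>R g t))"
    using assms unfolding set_integrable_def
    by (intro AE_integrable_convolution integrable_truncated_powr) auto
  then show ?thesis
  proof (intro AE_completion, eventually_elim)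
    case (elim x)
    have "(\<lambda>t. (indicator {0..b - a} (x - t) * (x - t) powr (\<alpha> - 1)) * (indicator {a..b} t *\<^sub>R g t))
      = (\<lambda>t. indicator {a..x} t *\<^sub>R (RL_kernel \<alpha> x t * g t))" if "x \<in> {a<..b}"
      using that by (intro ext) (auto simp: RL_kernel_def indicator_def)
    with elim show ?case
      by (auto simp: RL_exists_def set_integrable_def)
  qed
qed

lemma RL_exists_of_order_ge_1:
  assumes "\<alpha> \<ge> 1" and g: "set_integrable lebesgue {a..x} g"
  shows "RL_exists \<alpha> a g x"
  unfolding RL_exists_def
proof (rule absolutely_integrable_bounded_measurable_product_real)
  show "RL_kernel \<alpha> x \<in> borel_measurable (lebesgue_on {a..x})"
    by (intro measurable_restrict_space1 measurable_completion) simp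
  have "norm (RL_kernel \<alpha> x t) \<le> (x - a) powr (\<alpha> - 1)" if "t \<in> {a..x}" for t
    using that assms by (auto simp: RL_kernel_def intro!: powr_mono2)
  then show "bounded (RL_kernel \<alpha> x ` {a..x})"
    by (intro boundedI) blast
qed (use g in auto)

lemma RL_exists_of_continuous:
  assumes "\<alpha> > 0" "a \<le> x" "continuous_on {a..x} g"
  shows "RL_exists \<alpha> a g x"
  using set_integrable_continuous_mult[OF assms(3) set_integrable_RL_kernel[OF assms(1,2)]]
  by (simp add: RL_exists_def mult.commute)

section \<open>The mean value theorem for Riemann-Liouville integrals\<close>

lemma RL_mean_value:
  assumes "a < x" and f: "continuous_on {a..x} f" and sign: "no_sign_change_on {a..x} g"
    and g: "RL_exists \<alpha> a g x"
  shows "RL_exists \<alpha> a (\<lambda>t. f t * g t) x \<and> RL_exists \<alpha> a g x \<and>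
    (\<exists>\<xi>\<in>{a<..<x}. RL_integral \<alpha> a (\<lambda>t. f t * g t) x = f \<xi> * RL_integral \<alpha> a g x)"
proof -
  let ?w = "\<lambda>t. RL_kernel \<alpha> x t * g t"
  have comm: "RL_kernel \<alpha> x t * (f t * g t) = f t * ?w t" for t
    by simp
  have w: "set_integrable lebesgue {a..x} ?w"
    using g by (simp add: RL_exists_def)
  have "no_sign_change_on {a..x} ?w"
    using sign RL_kernel_nonneg unfolding no_sign_change_on_def
    by (auto intro: mult_nonneg_nonneg mult_nonneg_nonpos)
  from weighted_mean_value_interior[OF \<open>a < x\<close> f w this]
  have "\<exists>\<xi>\<in>{a<..<x}. RL_integral \<alpha> a (\<lambda>t. f t * g t) x = f \<xi> * RL_integral \<alpha> a g x"
    unfolding RL_integral_def comm by auto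
  moreover have "RL_exists \<alpha> a (\<lambda>t. f t * g t) x"
    unfolding RL_exists_def comm using set_integrable_continuous_mult[OF f w] .
  ultimately show ?thesis
    using g by blast
qed

theorem theorem2p1:
  fixes a b \<alpha> :: real and f g :: "real \<Rightarrow> real"
  assumes "a < b"
    and "\<alpha> > 0"
    and "continuous_on {a..b} f"
    and "set_integrable lebesgue {a..b} g"
    and "no_sign_change_on {a..b} g"
  shows "(AE x\<in>{a<..b} in lebesgue.
            RL_exists \<alpha> a (\<lambda>t. f t * g t) x \<and> RL_exists \<alpha> a g x \<and>
            (\<exists>\<xi>\<in>{a<..<x}. RL_integral \<alpha> a (\<lambda>t. f t * g t) x = f \<xi> * RL_integral \<alpha> a g x))
       \<and> (\<alpha> \<ge> 1 \<or> continuous_on {a..b} g \<longrightarrow>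
          (\<forall>x\<in>{a<..b}.
            RL_exists \<alpha> a (\<lambda>t. f t * g t) x \<and> RL_exists \<alpha> a g x \<and>
            (\<exists>\<xi>\<in>{a<..<x}. RL_integral \<alpha> a (\<lambda>t. f t * g t) x = f \<xi> * RL_integral \<alpha> a g x)))"
    (is "(AE x\<in>_ in _. ?mean x) \<and> (?regular \<longrightarrow> _)")
proof (rule conjI)
  have mean: "?mean x" if "x \<in> {a<..b}" "RL_exists \<alpha> a g x" for x
  proof (rule RL_mean_value)
    show "continuous_on {a..x} f"
      using assms(3) that(1) by (auto intro: continuous_on_subset)
    show "no_sign_change_on {a..x} g"
      using assms(5) that(1) by (auto simp: no_sign_change_on_def)
  qed (use that in auto)
  show "AE x\<in>{a<..b} in lebesgue. ?mean x"
    using AE_RL_exists[OF assms(2,1,4)] by eventually_elim (use mean in blast)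
  show "?regular \<longrightarrow> (\<forall>x\<in>{a<..b}. ?mean x)"
  proof (rule impI, rule ballI)
    fix x assume reg: ?regular and x: "x \<in> {a<..b}"
    have "RL_exists \<alpha> a g x"
      using reg
    proof
      assume "\<alpha> \<ge> 1"
      then show ?thesis
        using x assms(4) by (intro RL_exists_of_order_ge_1) (auto intro: set_integrable_subset)
    next
      assume "continuous_on {a..b} g"
      then show ?thesis
        using x assms(2) by (intro RL_exists_of_continuous) (auto intro: continuous_on_subset)
    qed
    with x show "?mean x"
      by (rule mean)
  qed
qed

end
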